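(* Let $b>1$ be an integer and let $S=S^\boxplus_{b,1}=(q_0,q_1,\dots)$ be any $S^\Box_{b,1}$-guided sequence in $[0,1)$ (for any $S^\Box_{b,1}$-sequence), with initial segments $S_N=(q_0,\dots,q_{N-1})$. Let $N\in\mathbb{N}$, $n=\lfloor\log(N)/\log(b)\rfloor$, $N=\sum_{j=0}^n\epsilon_jb^j$ its base-$b$ expansion (with $\epsilon_j\in\{0,\dots,b-1\}$), and $$M_b(N)=\min\Big\{\sum_{j=0}^n\epsilon_j,\ b(n+1)-n+1-\sum_{j=0}^n\epsilon_j\Big\}.$$ Then $$N\cdot\sqrt[p]{\mathcal{D}_p(S_N)}\ \le\ \begin{cases}2\cdot\sqrt[p]{\dfrac{M_b(N)}{p+1}} & \text{if } 0<p<1,\\[2ex] 2\cdot\dfrac{M_b(N)}{\sqrt[p]{p+1}} & \text{if } 1\le p<\infty,\end{cases}$$ and, for $p=\infty$, $N\cdot\mathcal{D}_\infty(S_N,T)\le 2M_b(N)$ with $T=\{[0,t]: 0<t<1\}$.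
   Context: $\mathbb{N}=\{1,2,\dots\}$. **Discrepancies on $[0,1)$** (reference measure: Lebesgue measure). For a multiset $X=\{x_1,\dots,x_N\}$ in $[0,1)$ and $0<p<\infty$, $$\mathcal{D}_p(X)=\frac1{N^p}\int_0^1\Big|\sum_{j=1}^N\chi_{[0,t)}(x_j)-Nt\Big|^p\,dt,\qquad \mathcal{D}_\infty(X,T)=\frac1N\sup_{A\in T}\Big|\sum_{j=1}^N\chi_A(x_j)-N|A|\Big|,$$ where $\chi_A$ is the indicator function of $A$ and $|A|$ its Lebesgue measure. **$S^\Box_{b,1}$-sequences.** Fix an enumeration $\{H_1,\dots,H_{b-1}\}=\{1,\dots,b-1\}$ and a sequence $\pi_0,\pi_1,\pi_2,\dots$ of permutations of $\{1,\dots,b-1\}$. Define recursively $s_0=0$ and, once $s_0,\dots,s_{b^m-1}$ are defined ($m\ge0$), $s_{k\cdot b^m+i}=b^{-m-1}H_{\pi_m(k)}+s_i$ for $1\le k\le b-1$, $0\le i<b^m$. Any sequence obtained this way is an $S^\Box_{b,1}$-sequence. **Guided sequences.** Given an $S^\Box_{b,1}$-sequence $(s_0,s_1,\dots)$, a sequence $(q_0,q_1,\dots)$ in $[0,1)$ is $S^\Box_{b,1}$-guided if $q_0\in[0,1)$ is arbitrary and for every integer $m\ge0$: (i) for all $v\in(b^{-m-1}\mathbb{Z})\cap[0,1)$, $|\{q_0,\dots,q_{b^{m+1}-1}\}\cap(b^{-(m+1)}[0,1)+v)|=1$; (ii) for every $0\le r<b^m$ and $1\le k<b$, $q_{r+k\cdot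 b^m}\in s_r+b^{-m}[0,1)$. *)

theory Defs
  imports
    "HOL-Analysis.Analysis"
    "HOL-Combinatorics.Permutations"
    "HOL-Library.Multiset"
begin

definition discr :: "real \<Rightarrow> real multiset \<Rightarrow> real" where
  "discr p X = 1 / real (size X) powr p *
     (LBINT t:{0..1}. \<bar>(\<Sum>x\<in>#X. indicator {0..<t} x) - real (size X) * t\<bar> powr p)"

text \<open>The supremum is a real one, hence meaningful only for a nonempty family \<open>T\<close>
  on which the expression is bounded, for instance measurable subsets of the unit interval.\<close>

definition discr_sup :: "real multiset \<Rightarrow> real set set \<Rightarrow> real" where
  "discr_sup X T = 1 / real (size X) *
     (SUP A\<in>T. \<bar>(\<Sum>x\<in>#X. indicator A x) - real (size X) * measure lebesgue A\<bar>)"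

definition S_box_seq :: "nat \<Rightarrow> (nat \<Rightarrow> real) \<Rightarrow> bool" where
  "S_box_seq b s \<longleftrightarrow>
     (\<exists>H \<pi>. bij_betw H {1..b - 1} {1..b - 1} \<and>
            (\<forall>m. \<pi> m permutes {1..b - 1}) \<and>
            s 0 = 0 \<and>
            (\<forall>m k i. 1 \<le> k \<longrightarrow> k \<le> b - 1 \<longrightarrow> i < b ^ m \<longrightarrow>
               s (k * b ^ m + i) = real (H (\<pi> m k)) / real b ^ (m + 1) + s i))"

text \<open>Intersecting with the set of the first \<open>b ^ (m + 1)\<close> points loses no multiplicities: by
  pigeonhole, one element in each of the \<open>b ^ (m + 1)\<close> disjoint intervals forces these points to be
  pairwise distinct.\<close>

definition S_box_guided :: "nat \<Rightarrow> (nat \<Rightarrow> real) \<Rightarrow> (nat \<Rightarrow> real) \<Rightarrow> bool" where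
  "S_box_guided b s q \<longleftrightarrow>
     (\<forall>i. q i \<in> {0..<1}) \<and>
     (\<forall>m. (\<forall>v \<in> {real_of_int a / real b ^ (m + 1) | a. True} \<inter> {0..<1}.
             card (q ` {0..<b ^ (m + 1)} \<inter> {v..<v + 1 / real b ^ (m + 1)}) = 1) \<and>
          (\<forall>r k. r < b ^ m \<longrightarrow> 1 \<le> k \<longrightarrow> k < b \<longrightarrow>
             q (r + k * b ^ m) \<in> {s r..<s r + 1 / real b ^ m}))"

definition initial_segment :: "(nat \<Rightarrow> real) \<Rightarrow> nat \<Rightarrow> real multiset" where
  "initial_segment q N = image_mset q (mset_set {0..<N})"

end

theory Submission
  imports Defs
begin

text \<open>A guided sequence is as well distributed as a van der Corput sequence: any \<open>b ^ j\<close> consecutive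
  points whose first index is a multiple of \<open>b ^ j\<close> occupy each of the \<open>b ^ j\<close> cells of length
  \<open>b ^ -j\<close> exactly once (\<open>guided_block_one_per_cell\<close>). The discrepancy function of such an aligned
  block is a sawtooth, zero at the cell boundaries, with one unit jump inside each cell. It is
  bounded by \<open>1\<close>, and the integral of its \<open>p\<close>-th power is at most \<open>1 / (p + 1)\<close>, the value for jumps
  at the ends of the cells (\<open>cell_point_discrepancy_le_1\<close>, \<open>cell_point_discrepancy_powr_integral\<close>).

  The discrepancy function is additive in the index set, so it remains to write \<open>[0, N)\<close> with few
  aligned blocks. The base \<open>b\<close> expansion of \<open>N\<close> cuts it into as many blocks as the digit sum.
  Alternatively, \<open>[0, N)\<close> is the one block \<open>[0, b ^ (n + 1))\<close> without the index \<open>N\<close> and the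
  indices above it, and the latter are cut into \<open>b - 1 - \<epsilon> j\<close> blocks of each length \<open>b ^ j\<close>. These
  are the two counts whose minimum is \<open>M\<close> (\<open>decomposition_by_digit_sum\<close>).

  With \<open>M\<close> blocks, the supremum bound is the triangle inequality. The \<open>p\<close>-norms are added by
  subadditivity of \<open>u powr p\<close> for \<open>p < 1\<close> and by the power mean inequality for \<open>p \<ge> 1\<close>
  (\<open>abs_sum_powr_le\<close>).\<close>

section \<open>Aligned blocks of guided sequences\<close>

text \<open>The two layers of choice, \<open>H\<close> and the permutations, only matter through a single family of
  injective digit maps \<open>G m\<close>. Letting \<open>G m\<close> fix \<open>0\<close> extends the recursion to the leading digit
  \<open>k = 0\<close>, so that it applies to every index below \<open>b ^ (m + 1)\<close> without a case distinction.\<close>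

lemma box_seq_digit_rule:
  assumes "b > 1" "S_box_seq b s"
  shows "\<exists>G :: nat \<Rightarrow> nat \<Rightarrow> nat. (\<forall>m. inj_on (G m) {..<b}) \<and> (\<forall>m. \<forall>k<b. G m k < b) \<and> s 0 = 0 \<and>
    (\<forall>m. \<forall>k<b. \<forall>i<b ^ m. s (k * b ^ m + i) = real (G m k) / real b ^ (m + 1) + s i)"
proof -
  obtain H \<pi> where H: "bij_betw H {1..b - 1} {1..b - 1}"
    and \<pi>: "\<And>m. \<pi> m permutes {1..b - 1}" and s0: "s 0 = 0"
    and rec: "\<And>m k i. 1 \<le> k \<Longrightarrow> k \<le> b - 1 \<Longrightarrow> i < b ^ m \<Longrightarrow>
               s (k * b ^ m + i) = real (H (\<pi> m k)) / real b ^ (m + 1) + s i"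
    using assms(2) unfolding S_box_seq_def by blast
  define G where "G m k = (if k = 0 then 0 else H (\<pi> m k))" for m k
  have bij: "bij_betw (\<lambda>k. H (\<pi> m k)) {1..b - 1} {1..b - 1}" for m
    using bij_betw_trans[OF permutes_imp_bij[OF \<pi>[of m]] H] by (simp add: comp_def)
  have range: "G m k \<in> {1..b - 1}" if "0 < k" "k < b" for m k
    using bij_betwE[OF bij[of m]] that by (auto simp: G_def)
  show ?thesis
  proof (intro exI conjI allI impI)
    show "inj_on (G m) {..<b}" for m
    proof (rule inj_onI)
      fix k l assume kl: "k \<in> {..<b}" "l \<in> {..<b}" "G m k = G m l"
      show "k = l"
      proof (cases "k = 0 \<or> l = 0")
        case True
        then show ?thesis using kl range[of k m] range[of l m] by (auto simp: G_def split: if_splits)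
      next
        case False
        with kl have "k \<in> {1..b - 1}" "l \<in> {1..b - 1}" "H (\<pi> m k) = H (\<pi> m l)"
          by (auto simp: G_def)
        then show ?thesis
          using inj_onD[OF bij_betw_imp_inj_on[OF bij[of m]]] by blast
      qed
    qed
    show "G m k < b" if "k < b" for m k
      using range[of k m] that assms(1) by (cases "k = 0") (auto simp: G_def)
    show "s (k * b ^ m + i) = real (G m k) / real b ^ (m + 1) + s i" if "k < b" "i < b ^ m" for m k i
      using rec[of k i m] that by (cases "k = 0") (auto simp: G_def)
  qed (rule s0)
qed

text \<open>The numerator of \<open>s i\<close> over \<open>b ^ m\<close> is the digit reversal of \<open>i\<close>, twisted by the maps \<open>G\<close>:
  going from \<open>m\<close> to \<open>m + 1\<close>, the leading digit of the index supplies a new last digit of the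
  numerator, and both can be recovered from it.\<close>

lemma box_seq_permutes_grid:
  assumes "b > 1" "S_box_seq b s"
  shows "\<exists>c::nat \<Rightarrow> nat. bij_betw c {..<b ^ m} {..<b ^ m} \<and> (\<forall>i<b ^ m. s i = real (c i) / real b ^ m)"
proof -
  obtain G :: "nat \<Rightarrow> nat \<Rightarrow> nat" where inj: "\<And>m. inj_on (G m) {..<b}"
    and ran: "\<And>m k. k < b \<Longrightarrow> G m k < b" and s0: "s 0 = 0"
    and rec: "\<And>m k i. k < b \<Longrightarrow> i < b ^ m \<Longrightarrow>
                s (k * b ^ m + i) = real (G m k) / real b ^ (m + 1) + s i"
    using box_seq_digit_rule[OF assms] by metis
  show ?thesis
  proof (induction m)
    case 0
    show ?case using s0 by (intro exI[of _ "\<lambda>_. 0"]) (auto simp: bij_betw_def inj_on_def)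
  next
    case (Suc m)
    then obtain c :: "nat \<Rightarrow> nat" where c: "bij_betw c {..<b ^ m} {..<b ^ m}"
      and sc: "\<And>i. i < b ^ m \<Longrightarrow> s i = real (c i) / real b ^ m" by blast
    define d where "d i = b * c (i mod b ^ m) + G m (i div b ^ m)" for i
    have pos: "b ^ m > 0" using assms(1) by simp
    have quot: "i div b ^ m < b" if "i < b ^ Suc m" for i
      using that pos by (simp add: less_mult_imp_div_less)
    have cran: "c (i mod b ^ m) < b ^ m" for i
      using bij_betwE[OF c] pos by simp
    have "inj_on d {..<b ^ Suc m}"
    proof (rule inj_onI)
      fix i j assume ij: "i \<in> {..<b ^ Suc m}" "j \<in> {..<b ^ Suc m}" "d i = d j"
      have lt: "G m (i div b ^ m) < b" "G m (j div b ^ m) < b"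
        using ran quot ij by auto
      have "d i mod b = G m (i div b ^ m)" "d j mod b = G m (j div b ^ m)"
        using lt by (simp_all add: d_def)
      then have G: "G m (i div b ^ m) = G m (j div b ^ m)" using ij by simp
      then have "i div b ^ m = j div b ^ m"
        using inj_onD[OF inj[of m]] quot ij by simp
      moreover have "c (i mod b ^ m) = c (j mod b ^ m)"
        using ij(3) G assms(1) by (simp add: d_def)
      then have "i mod b ^ m = j mod b ^ m"
        using inj_onD[OF bij_betw_imp_inj_on[OF c]] pos by simp
      ultimately show "i = j" by (metis div_mult_mod_eq)
    qed
    moreover have "d i < b ^ Suc m" if "i < b ^ Suc m" for i
    proof -
      have "d i < b * c (i mod b ^ m) + b" using ran quot that by (simp add: d_def)
      also have "\<dots> = b * Suc (c (i mod b ^ m))" by simp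
      also have "\<dots> \<le> b * b ^ m" using cran[of i] by (intro mult_le_mono2) simp
      finally show ?thesis by simp
    qed
    ultimately have "bij_betw d {..<b ^ Suc m} {..<b ^ Suc m}"
      by (intro bij_betw_imageI endo_inj_surj) auto
    moreover have "s i = real (d i) / real b ^ Suc m" if "i < b ^ Suc m" for i
    proof -
      have "s i = s (i div b ^ m * b ^ m + i mod b ^ m)" by (simp only: div_mult_mod_eq)
      also have "\<dots> = real (G m (i div b ^ m)) / real b ^ (m + 1) + real (c (i mod b ^ m)) / real b ^ m"
        using rec[OF quot[OF that], of "i mod b ^ m"] sc[of "i mod b ^ m"] pos by simp
      also have "\<dots> = real (d i) / real b ^ Suc m"
        using assms(1) by (simp add: d_def field_simps)
      finally show ?thesis .
    qed
    ultimately show ?case by blast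
  qed
qed

text \<open>The digits of an index above position \<open>j\<close> only influence the digits of \<open>s\<close> beyond the \<open>j\<close>-th
  place after the radix point. Hence an aligned block of \<open>b ^ j\<close> values of \<open>s\<close> is a copy of the
  first block, shifted by less than one cell of length \<open>b ^ -j\<close>.\<close>

lemma box_seq_shift_on_block:
  assumes "b > 1" "S_box_seq b s"
  shows "\<exists>\<delta>. 0 \<le> \<delta> \<and> \<delta> < 1 / real b ^ j \<and> (\<forall>i<b ^ j. s (a * b ^ j + i) = s i + \<delta>)"
proof -
  obtain G :: "nat \<Rightarrow> nat \<Rightarrow> nat" where "\<And>m. inj_on (G m) {..<b}"
    and ran: "\<And>m k. k < b \<Longrightarrow> G m k < b" and "s 0 = 0"
    and rec: "\<And>m k i. k < b \<Longrightarrow> i < b ^ m \<Longrightarrow>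
                s (k * b ^ m + i) = real (G m k) / real b ^ (m + 1) + s i"
    using box_seq_digit_rule[OF assms] by metis
  \<comment> \<open>The shift is a sum of digits in places \<open>j + 1\<close> to \<open>m + j\<close>; the bound is its value when all
    these digits are \<open>b - 1\<close>, which is what makes the induction close.\<close>
  have "\<forall>a<b ^ m. \<exists>\<delta>. 0 \<le> \<delta> \<and> \<delta> \<le> 1 / real b ^ j - 1 / real b ^ (m + j)
           \<and> (\<forall>i<b ^ j. s (a * b ^ j + i) = s i + \<delta>)" for m
  proof (induction m)
    case 0
    show ?case by (auto intro!: exI[of _ 0])
  next
    case (Suc m)
    show ?case
    proof (intro allI impI)
      fix a assume a: "a < b ^ Suc m"
      define k where "k = a div b ^ m"
      have pos: "b ^ m > 0" using assms(1) by simp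
      have k: "k < b" unfolding k_def using a pos by (simp add: less_mult_imp_div_less)
      obtain \<delta> where d: "0 \<le> \<delta>" "\<delta> \<le> 1 / real b ^ j - 1 / real b ^ (m + j)"
        and sd: "\<And>i. i < b ^ j \<Longrightarrow> s (a mod b ^ m * b ^ j + i) = s i + \<delta>"
        using Suc.IH pos by (meson mod_less_divisor)
      have "s (a * b ^ j + i) = s i + (real (G (m + j) k) / real b ^ (m + j + 1) + \<delta>)"
        if i: "i < b ^ j" for i
      proof -
        have "a mod b ^ m * b ^ j + i < Suc (a mod b ^ m) * b ^ j" using i by simp
        also have "\<dots> \<le> b ^ m * b ^ j"
          using pos by (intro mult_le_mono1) (simp add: Suc_leI)
        finally have lt: "a mod b ^ m * b ^ j + i < b ^ (m + j)" by (simp add: power_add)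
        have "a * b ^ j + i = (k * b ^ m + a mod b ^ m) * b ^ j + i"
          by (simp only: k_def div_mult_mod_eq)
        also have "\<dots> = k * b ^ (m + j) + (a mod b ^ m * b ^ j + i)"
          by (simp add: power_add algebra_simps)
        finally have "a * b ^ j + i = k * b ^ (m + j) + (a mod b ^ m * b ^ j + i)" .
        then show ?thesis using rec[OF k lt] sd[OF i] by (simp only: add.assoc add.left_commute)
      qed
      moreover have "real (G (m + j) k) / real b ^ (m + j + 1) + \<delta>
          \<le> 1 / real b ^ j - 1 / real b ^ (Suc m + j)"
      proof -
        have "real (G (m + j) k) + 1 \<le> real b" using ran[OF k, of "m + j"] by linarith
        then have "real (G (m + j) k) / real b ^ (m + j + 1) \<le> (real b - 1) / real b ^ (m + j + 1)"
          by (intro divide_right_mono) auto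
        also have "\<dots> = 1 / real b ^ (m + j) - 1 / real b ^ (Suc m + j)"
          using assms(1) by (simp add: field_simps)
        finally show ?thesis using d by simp
      qed
      ultimately show "\<exists>\<delta>. 0 \<le> \<delta> \<and> \<delta> \<le> 1 / real b ^ j - 1 / real b ^ (Suc m + j)
           \<and> (\<forall>i<b ^ j. s (a * b ^ j + i) = s i + \<delta>)"
        using d by (intro exI[of _ "real (G (m + j) k) / real b ^ (m + j + 1) + \<delta>"]) auto
    qed
  qed
  moreover have "a < b ^ a" using assms(1) power_gt_expt[of b a] by simp
  ultimately obtain \<delta> where "0 \<le> \<delta>" "\<delta> \<le> 1 / real b ^ j - 1 / real b ^ (a + j)"
    "\<forall>i<b ^ j. s (a * b ^ j + i) = s i + \<delta>" by blast
  moreover have "0 < 1 / real b ^ (a + j)" using assms(1) by simp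
  moreover from calculation have "\<delta> < 1 / real b ^ j" by linarith
  ultimately show ?thesis by blast
qed

text \<open>These are the index intervals on which a digital construction repeats its first \<open>b ^ j\<close> steps;
  cutting \<open>[0, N)\<close> at multiples of decreasing powers of \<open>b\<close> produces exactly such intervals.\<close>

definition aligned_block :: "nat \<Rightarrow> nat \<Rightarrow> nat \<Rightarrow> nat set" where
  "aligned_block b j a = {a * b ^ j..<(a + 1) * b ^ j}"

lemma finite_aligned_block [simp]: "finite (aligned_block b j a)"
  and card_aligned_block [simp]: "card (aligned_block b j a) = b ^ j"
  by (simp_all add: aligned_block_def)

text \<open>This is the (0,1)-sequence property of guided sequences, the only place where the definition of
  guidedness is used beyond \<open>q i \<in> [0, 1)\<close>. An initial block is covered by the first condition of
  that definition. For any other block let \<open>b ^ n\<close> be the largest power of \<open>b\<close> not above its first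
  index; the block is \<open>k * b ^ n\<close> plus an aligned block of smaller indices, with one digit \<open>k \<ge> 1\<close>,
  so by the second condition its points follow those of \<open>s\<close> up to less than \<open>b ^ -n\<close>. Points of
  \<open>s\<close> used there lie on the grid of mesh \<open>b ^ -n\<close>, which refines the cells of length \<open>b ^ -j\<close>;
  hence the error does not carry a point out of the cell of its guide, and the guides occupy
  every cell once.\<close>

lemma guided_block_one_per_cell:
  assumes "b > 1" "S_box_seq b s" "S_box_guided b s q"
  shows "bij_betw (\<lambda>i. nat \<lfloor>real (b ^ j) * q i\<rfloor>) (aligned_block b j a) {..<b ^ j}"
proof -
  define f where "f i = nat \<lfloor>real (b ^ j) * q i\<rfloor>" for i
  have pos: "0 < real (b ^ j)" "0 < b ^ j" using assms(1) by simp_all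
  have q01: "0 \<le> q i" "q i < 1" for i
    using assms(3) unfolding S_box_guided_def by auto
  have fran: "f i < b ^ j" for i
  proof -
    have "real (b ^ j) * q i < real (b ^ j) * 1" using pos q01 by (intro mult_strict_left_mono)
    then have "\<lfloor>real (b ^ j) * q i\<rfloor> < int (b ^ j)" by (simp add: floor_less_iff)
    moreover have "0 \<le> \<lfloor>real (b ^ j) * q i\<rfloor>" using pos q01 by simp
    ultimately show ?thesis unfolding f_def by linarith
  qed
  have feq: "f i = c" if "real c / real b ^ j \<le> q i" "q i < (real c + 1) / real b ^ j" for i c
  proof -
    have "\<lfloor>real (b ^ j) * q i\<rfloor> = int c"
      using that pos by (intro floor_unique) (auto simp: field_simps)
    then show ?thesis by (simp add: f_def)
  qed
  \<comment> \<open>The block has as many indices as there are cells, so hitting every cell suffices.\<close>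
  have "{..<b ^ j} \<subseteq> f ` aligned_block b j a"
  proof (cases "a = 0 \<or> j = 0")
    case True
    show ?thesis
    proof (cases "j = 0")
      case True
      then show ?thesis using fran[of a] by (auto simp: aligned_block_def)
    next
      case False
      then obtain m where j: "j = m + 1" by (cases j) auto
      from False True have a: "a = 0" by simp
      show ?thesis
      proof
        fix c assume c: "c \<in> {..<b ^ j}"
        let ?v = "real_of_int (int c) / real b ^ (m + 1)"
        have "real c < real b ^ (m + 1)" using c unfolding j
          by (metis lessThan_iff of_nat_less_iff of_nat_power)
        then have "?v \<in> {0..<1}" using assms(1) by (simp add: divide_less_eq)
        then have "?v \<in> {real_of_int a / real b ^ (m + 1) | a. True} \<inter> {0..<1}" by blast
        then have "card (q ` {0..<b ^ (m + 1)} \<inter> {?v..<?v + 1 / real b ^ (m + 1)}) = 1"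
          using assms(3) unfolding S_box_guided_def by blast
        then have "q ` {0..<b ^ (m + 1)} \<inter> {?v..<?v + 1 / real b ^ (m + 1)} \<noteq> {}" by force
        then obtain i where "i < b ^ j" "?v \<le> q i" "q i < ?v + 1 / real b ^ (m + 1)"
          unfolding j by force
        then have "f i = c" "i \<in> aligned_block b j a"
          using feq[of c i] a by (auto simp: j aligned_block_def add_divide_distrib)
        then show "c \<in> f ` aligned_block b j a" by blast
      qed
    qed
  next
    case False
    then have a: "a \<noteq> 0" by simp
    obtain n where n: "b ^ n \<le> a * b ^ j" "a * b ^ j < b ^ (n + 1)"
      using ex_power_ivl1[of b "a * b ^ j"] assms(1) a pos by auto
    have "b ^ j \<le> a * b ^ j" using a by simp
    then have "b ^ j < b ^ (n + 1)" using n by linarith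
    then have jn: "j \<le> n" using assms(1) power_less_imp_less_exp[of b j "n + 1"] by simp
    define w where "w = b ^ (n - j)"
    have w: "w > 0" "b ^ n = w * b ^ j" using assms(1) jn by (auto simp: w_def simp flip: power_add)
    define k where "k = a div w"
    define r where "r = a mod w"
    have akr: "a = k * w + r" by (simp add: k_def r_def)
    have "w \<le> a" using n(1) w assms(1) by auto
    then have k1: "1 \<le> k" unfolding k_def using w by (simp add: Suc_leI div_greater_zero_iff)
    have "a < b * w" using n(2) w assms(1) by (auto simp: mult.assoc[symmetric])
    then have kb: "k < b" unfolding k_def by (simp add: less_mult_imp_div_less)
    have rw: "r < w" using w by (simp add: r_def)
    obtain \<delta> where d: "0 \<le> \<delta>" "\<delta> < 1 / real b ^ j"
      and sd: "\<And>i. i < b ^ j \<Longrightarrow> s (r * b ^ j + i) = s i + \<delta>"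
      using box_seq_shift_on_block[OF assms(1,2)] by blast
    obtain c :: "nat \<Rightarrow> nat" where c: "bij_betw c {..<b ^ j} {..<b ^ j}"
      and sc: "\<And>i. i < b ^ j \<Longrightarrow> s i = real (c i) / real b ^ j"
      using box_seq_permutes_grid[OF assms(1,2)] by blast
    obtain g :: "nat \<Rightarrow> nat" where sg: "\<And>i. i < b ^ n \<Longrightarrow> s i = real (g i) / real b ^ n"
      using box_seq_permutes_grid[OF assms(1,2)] by blast
    have fc: "f (a * b ^ j + i) = c i" if i: "i < b ^ j" for i
    proof (rule feq)
      have "r * b ^ j + i < (r + 1) * b ^ j" using i by simp
      also have "\<dots> \<le> w * b ^ j" using rw by (intro mult_le_mono1) simp
      finally have lt: "r * b ^ j + i < b ^ n" by (simp add: w)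
      let ?s = "s (r * b ^ j + i)"
      have idx: "a * b ^ j + i = (r * b ^ j + i) + k * b ^ n"
        by (simp add: akr w algebra_simps)
      have q: "?s \<le> q (a * b ^ j + i)" "q (a * b ^ j + i) < ?s + 1 / real b ^ n"
        using assms(3) lt k1 kb unfolding S_box_guided_def idx by auto
      have s_eq: "?s = real (c i) / real b ^ j + \<delta>" using sd[OF i] sc[OF i] by simp
      then show "real (c i) / real b ^ j \<le> q (a * b ^ j + i)" using q d by simp
      have "?s < (real (c i) + 1) / real b ^ j" using s_eq d by (simp add: add_divide_distrib)
      \<comment> \<open>The guide and the right end of its cell are multiples of \<open>b ^ -n\<close>, so they differ by at least one
        mesh width, and \<open>q\<close> exceeds its guide by less than that.\<close>
      then have "real (b ^ j) * ?s < real (c i) + 1"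
        using assms(1) by (simp add: field_simps)
      then have "real w * (real (b ^ j) * ?s) < real w * (real (c i) + 1)"
        using w by (intro mult_strict_left_mono) auto
      moreover have gs: "real w * (real (b ^ j) * ?s) = real (g (r * b ^ j + i))"
        using sg[OF lt] w assms(1) by (simp add: field_simps flip: of_nat_power)
      ultimately have "real (g (r * b ^ j + i)) < real (w * (c i + 1))"
        by (simp add: algebra_simps)
      then have "g (r * b ^ j + i) + 1 \<le> w * (c i + 1)" by linarith
      then have "real (g (r * b ^ j + i) + 1) \<le> real (w * (c i + 1))" by (simp only: of_nat_le_iff)
      then have "real (g (r * b ^ j + i)) + 1 \<le> real w * (real (c i) + 1)"
        by (simp only: of_nat_add of_nat_mult of_nat_1)
      then have "real w * (real (b ^ j) * ?s) + 1 \<le> real w * (real (c i) + 1)"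
        by (simp only: gs)
      then have "(real w * (real (b ^ j) * ?s) + 1) / (real w * real (b ^ j))
          \<le> real w * (real (c i) + 1) / (real w * real (b ^ j))"
        by (intro divide_right_mono) auto
      then have "?s + 1 / (real w * real (b ^ j)) \<le> (real (c i) + 1) / real (b ^ j)"
        using w(1) assms(1) by (simp add: add_divide_distrib del: of_nat_power)
      moreover have "real b ^ n = real w * real (b ^ j)" using w(2) by (simp flip: of_nat_power)
      ultimately have "?s + 1 / real b ^ n \<le> (real (c i) + 1) / real b ^ j" by simp
      then show "q (a * b ^ j + i) < (real (c i) + 1) / real b ^ j" using q by simp
    qed
    show ?thesis
    proof
      fix y assume "y \<in> {..<b ^ j}"
      then have "y \<in> c ` {..<b ^ j}" using bij_betw_imp_surj_on[OF c] by simp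
      then obtain i where i: "i < b ^ j" "c i = y" by blast
      then have "f (a * b ^ j + i) = y" "a * b ^ j + i \<in> aligned_block b j a"
        using fc by (auto simp: aligned_block_def)
      then show "y \<in> f ` aligned_block b j a" by blast
    qed
  qed
  moreover have "f ` aligned_block b j a \<subseteq> {..<b ^ j}" using fran by auto
  ultimately have im: "f ` aligned_block b j a = {..<b ^ j}" by blast
  then have "inj_on f (aligned_block b j a)" by (intro eq_card_imp_inj_on) auto
  then show ?thesis using im unfolding f_def bij_betw_def by simp
qed

section \<open>Sums of powers\<close>

text \<open>For \<open>p < 1\<close> this is subadditivity of the power: normalise the sum to \<open>1\<close> and use \<open>u \<le> u powr p\<close>
  on the unit interval. For \<open>p \<ge> 1\<close> it is the power mean inequality. The latter replaces
  Minkowski's inequality below: when all summands share one bound on their \<open>p\<close>-norm, integrating it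
  yields the same constant.\<close>

lemma abs_sum_powr_le:
  fixes y :: "'a \<Rightarrow> real"
  assumes "finite L" "0 < p"
  shows "\<bar>\<Sum>i\<in>L. y i\<bar> powr p
           \<le> (if p < 1 then 1 else real (card L) powr (p - 1)) * (\<Sum>i\<in>L. \<bar>y i\<bar> powr p)"
proof -
  have nonneg_case: "(\<Sum>i\<in>L. z i) powr p
           \<le> (if p < 1 then 1 else real (card L) powr (p - 1)) * (\<Sum>i\<in>L. z i powr p)"
    if z: "\<And>i. i \<in> L \<Longrightarrow> 0 \<le> z i" for z :: "'a \<Rightarrow> real"
  proof (cases "(\<Sum>i\<in>L. z i) = 0")
    case True
    then show ?thesis using assms(2) by (auto intro!: mult_nonneg_nonneg sum_nonneg)
  next
    case False
    define Z where "Z = (\<Sum>i\<in>L. z i)"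
    have Z: "Z > 0" using False sum_nonneg[of L z] z unfolding Z_def by force
    show ?thesis
    proof (cases "p < 1")
      case True
      have "1 = (\<Sum>i\<in>L. z i / Z)" using Z by (simp add: Z_def flip: sum_divide_distrib)
      also have "\<dots> \<le> (\<Sum>i\<in>L. (z i / Z) powr p)"
      proof (rule sum_mono)
        fix i assume i: "i \<in> L"
        have "z i \<le> Z" unfolding Z_def using assms(1) i z by (intro member_le_sum) auto
        then have "(z i / Z) powr 1 \<le> (z i / Z) powr p"
          using Z z[OF i] True by (intro powr_mono') auto
        then show "z i / Z \<le> (z i / Z) powr p" using Z z[OF i] by simp
      qed
      also have "\<dots> = (\<Sum>i\<in>L. z i powr p) / Z powr p"
        using Z z by (simp add: powr_divide sum_divide_distrib)
      finally show ?thesis using Z True by (simp add: Z_def[symmetric] field_simps)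
    next
      case False
      \<comment> \<open>Removing the zero terms places the others in the open half-line, where the power is convex.\<close>
      define P where "P = {i \<in> L. z i > 0}"
      have P: "finite P" "P \<subseteq> L" using assms(1) by (auto simp: P_def)
      have "z i = 0" if "i \<in> L - P" for i
        using that z[of i] by (auto simp: P_def)
      then have sums: "(\<Sum>i\<in>P. z i) = Z" "(\<Sum>i\<in>P. z i powr p) = (\<Sum>i\<in>L. z i powr p)"
        unfolding Z_def using assms P by (auto intro!: sum.mono_neutral_left)
      then have "P \<noteq> {}" using Z by auto
      then have c: "0 < card P" "card P \<le> card L"
        using P assms(1) by (auto intro: card_mono simp: card_gt_0_iff)
      have "(\<Sum>i\<in>P. (1 / real (card P)) *\<^sub>R z i) powr p \<le> (\<Sum>i\<in>P. (1 / real (card P)) * z i powr p)"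
        using False \<open>P \<noteq> {}\<close> P c
        by (intro convex_on_sum[OF _ _ powr_convex]) (auto simp: P_def)
      then have "(Z / real (card P)) powr p \<le> (\<Sum>i\<in>L. z i powr p) / real (card P)"
        using sums by (simp flip: sum_divide_distrib)
      then have "Z powr p \<le> real (card P) powr p / real (card P) * (\<Sum>i\<in>L. z i powr p)"
        using Z c by (simp add: powr_divide field_simps)
      also have "real (card P) powr p / real (card P) = real (card P) powr (p - 1)"
        using c by (simp add: powr_diff)
      also have "\<dots> * (\<Sum>i\<in>L. z i powr p) \<le> real (card L) powr (p - 1) * (\<Sum>i\<in>L. z i powr p)"
        using False c by (intro mult_right_mono powr_mono2 sum_nonneg) auto
      finally show ?thesis using False by (simp add: Z_def)
    qed
  qed
  have "\<bar>\<Sum>i\<in>L. y i\<bar> powr p \<le> (\<Sum>i\<in>L. \<bar>y i\<bar>) powr p"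
    using assms(2) by (intro powr_mono2) auto
  also note nonneg_case[of "\<lambda>i. \<bar>y i\<bar>"]
  finally show ?thesis by simp
qed

section \<open>One point in each cell\<close>

text \<open>The sign of \<open>k\<close> is free so that both the rising and the falling teeth of the sawtooth below are
  instances. Vanishing of the affine function is allowed at the end points only, where the power
  need not be differentiable.\<close>

lemma has_integral_affine_powr:
  fixes k c p \<alpha> \<beta> :: real
  assumes "k \<noteq> 0" "p > 0" "\<alpha> \<le> \<beta>" "0 \<le> k * \<alpha> - c" "0 \<le> k * \<beta> - c"
  shows "((\<lambda>t. (k * t - c) powr p) has_integral
           ((k * \<beta> - c) powr (p + 1) - (k * \<alpha> - c) powr (p + 1)) / (k * (p + 1))) {\<alpha>..\<beta>}"
proof -
  define F where "F t = (k * t - c) powr (p + 1) / (k * (p + 1))" for t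
  have pos: "0 < k * t - c" if t: "t \<in> {\<alpha><..<\<beta>}" for t
  proof (cases "k > 0")
    case True
    then have "k * \<alpha> < k * t" using t by simp
    then show ?thesis using assms by simp
  next
    case False
    then have "k * \<beta> < k * t" using t assms(1) by simp
    then show ?thesis using assms by simp
  qed
  have nonneg: "0 \<le> k * t - c" if t: "t \<in> {\<alpha>..\<beta>}" for t
    using pos[of t] t assms by (cases "t = \<alpha> \<or> t = \<beta>") (auto simp: less_eq_real_def)
  have "((\<lambda>t. (k * t - c) powr p) has_integral (F \<beta> - F \<alpha>)) {\<alpha>..\<beta>}"
  proof (rule fundamental_theorem_of_calculus_interior[OF assms(3)])
    show "continuous_on {\<alpha>..\<beta>} F"
      unfolding F_def using nonneg assms by (intro continuous_intros continuous_on_powr') auto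
    fix t assume "t \<in> {\<alpha><..<\<beta>}"
    then have "(F has_real_derivative (k * t - c) powr p) (at t)"
      unfolding F_def using pos[of t] assms by (auto intro!: derivative_eq_intros)
    then show "(F has_vector_derivative (k * t - c) powr p) (at t)"
      by (simp add: has_real_derivative_iff_has_vector_derivative)
  qed
  then show ?thesis by (simp add: F_def diff_divide_distrib)
qed

text \<open>Allowing any set between \<open>{0..<t}\<close> and \<open>{0..t}\<close> treats the half-open intervals of the
  \<open>p\<close>-discrepancy and the closed ones of the star discrepancy at once.\<close>

lemma count_before_cell_point:
  fixes x :: "nat \<Rightarrow> real"
  assumes x: "\<And>d. d < K \<Longrightarrow> x d \<in> {real d / real K..<(real d + 1) / real K}"
    and "c < K" "t \<in> {real c / real K..<(real c + 1) / real K}"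
    and B: "{0..<t} \<subseteq> B" "B \<subseteq> {0..t}"
  shows "(\<Sum>d<K. indicator B (x d)) = real c + indicator B (x c)"
proof -
  have K: "real K > 0" using assms(2) by simp
  have "indicator B (x d) = (if d < c then 1 else if d = c then indicator B (x c) else 0 :: real)"
    if d: "d < K" for d
  proof -
    have "0 \<le> real d / real K" using K by simp
    moreover have xd: "real d / real K \<le> x d" "x d < (real d + 1) / real K" using x[OF d] by auto
    ultimately have "0 \<le> x d" by linarith
    have "x d \<in> B" if "d < c"
    proof -
      have "(real d + 1) / real K \<le> real c / real K" using that by (intro divide_right_mono) auto
      then have "x d \<in> {0..<t}" using xd \<open>0 \<le> x d\<close> assms(3) by auto
      then show ?thesis using B by blast
    qed
    moreover have "x d \<notin> B" if "d > c"
    proof -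
      have "(real c + 1) / real K \<le> real d / real K" using that by (intro divide_right_mono) auto
      then have "x d \<notin> {0..t}" using xd \<open>0 \<le> x d\<close> assms(3) by auto
      then show ?thesis using B by blast
    qed
    ultimately show ?thesis by (auto simp: indicator_def)
  qed
  then have "(\<Sum>d<K. indicator B (x d))
      = (\<Sum>d<K. if d < c then 1 else if d = c then indicator B (x c) else 0 :: real)"
    by (intro sum.cong) auto
  also have "\<dots> = (\<Sum>d<Suc c. if d < c then 1 else if d = c then indicator B (x c) else 0 :: real)"
    using assms(2) by (intro sum.mono_neutral_right) auto
  also have "\<dots> = real c + indicator B (x c)" by simp
  finally show ?thesis .
qed

lemma cell_point_discrepancy_le_1:
  fixes x :: "nat \<Rightarrow> real"
  assumes x: "\<And>d. d < K \<Longrightarrow> x d \<in> {real d / real K..<(real d + 1) / real K}"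
    and "K > 0" "0 \<le> t" "t < 1" and B: "{0..<t} \<subseteq> B" "B \<subseteq> {0..t}"
  shows "\<bar>(\<Sum>d<K. indicator B (x d)) - real K * t\<bar> \<le> 1"
proof -
  define c where "c = nat \<lfloor>real K * t\<rfloor>"
  have c: "real c \<le> real K * t" "real K * t < real c + 1"
    using assms by (auto simp: c_def of_nat_floor)
  moreover have "real K * t < real K" using assms by simp
  ultimately have "c < K" by linarith
  moreover have "t \<in> {real c / real K..<(real c + 1) / real K}"
    using c assms(2) by (auto simp: field_simps)
  ultimately have "(\<Sum>d<K. indicator B (x d)) = real c + indicator B (x c)"
    using x B by (intro count_before_cell_point)
  moreover have "indicator B (x c) \<in> {0, 1 :: real}" by (auto simp: indicator_def)
  ultimately show ?thesis using c by auto
qed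

text \<open>Inside a cell the discrepancy function is the sawtooth that falls from \<open>0\<close>, jumps by \<open>1\<close> at the
  point of the cell, and falls back to \<open>0\<close>. If the point sits at the fraction \<open>\<alpha>\<close> of the cell, the
  integral is \<open>(\<alpha> powr (p + 1) + (1 - \<alpha>) powr (p + 1)) / (K * (p + 1))\<close>, and the numerator is at
  most \<open>\<alpha> + (1 - \<alpha>) = 1\<close>.\<close>

lemma one_cell_integral:
  fixes p x :: real
  assumes "p > 0" "K > 0" "x \<in> {real c / real K..(real c + 1) / real K}"
  shows "\<exists>I \<le> 1 / (real K * (p + 1)). ((\<lambda>t. \<bar>indicator {0..<t} x - (real K * t - real c)\<bar> powr p)
           has_integral I) {real c / real K..(real c + 1) / real K}"
proof -
  define \<alpha> where "\<alpha> = real K * x - real c"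
  let ?f = "\<lambda>t. \<bar>indicator {0..<t} x - (real K * t - real c)\<bar> powr p"
  have \<alpha>: "0 \<le> \<alpha>" "\<alpha> \<le> 1" using assms by (auto simp: \<alpha>_def field_simps)
  have "0 \<le> real c / real K" using assms(2) by simp
  then have x0: "0 \<le> x" using assms(3) by (meson atLeastAtMost_iff order_trans)
  have "((\<lambda>t. (real K * t - real c) powr p) has_integral
      (\<alpha> powr (p + 1) - 0 powr (p + 1)) / (real K * (p + 1))) {real c / real K..x}"
    using has_integral_affine_powr[of "real K" p "real c / real K" x "real c"] assms \<alpha>
    by (simp add: \<alpha>_def)
  then have left: "(?f has_integral (\<alpha> powr (p + 1) / (real K * (p + 1)))) {real c / real K..x}"
    using assms(2) by (subst has_integral_cong[where g = "\<lambda>t. (real K * t - real c) powr p"])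
      (auto simp: field_simps)
  have ends: "- real K * ((real c + 1) / real K) - (- real c - 1) = 0"
    "- real K * x - (- real c - 1) = 1 - \<alpha>"
    using assms(2) by (simp_all add: \<alpha>_def)
  have "((\<lambda>t. (- real K * t - (- real c - 1)) powr p) has_integral
      (0 powr (p + 1) - (1 - \<alpha>) powr (p + 1)) / (- real K * (p + 1))) {x..(real c + 1) / real K}"
    using has_integral_affine_powr[of "- real K" p x "(real c + 1) / real K" "- real c - 1"] assms \<alpha>
    unfolding ends by simp
  moreover have "(0 powr (p + 1) - (1 - \<alpha>) powr (p + 1)) / (- real K * (p + 1))
      = (1 - \<alpha>) powr (p + 1) / (real K * (p + 1))"
    by (simp add: minus_divide_left[symmetric] flip: minus_divide_right)
  ultimately have "((\<lambda>t. (- real K * t - (- real c - 1)) powr p) has_integral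
      ((1 - \<alpha>) powr (p + 1) / (real K * (p + 1)))) {x..(real c + 1) / real K}" by simp
  then have right: "(?f has_integral ((1 - \<alpha>) powr (p + 1) / (real K * (p + 1)))) {x..(real c + 1) / real K}"
    using assms(2) x0
    by (rule_tac has_integral_spike_finite[of "{x}"]) (auto simp: indicator_def field_simps)
  have "\<alpha> powr (p + 1) \<le> \<alpha> powr 1" "(1 - \<alpha>) powr (p + 1) \<le> (1 - \<alpha>) powr 1"
    using \<alpha> assms(1) by (intro powr_mono'; simp)+
  then have "\<alpha> powr (p + 1) + (1 - \<alpha>) powr (p + 1) \<le> 1" using \<alpha> by simp
  then have "(\<alpha> powr (p + 1) + (1 - \<alpha>) powr (p + 1)) / (real K * (p + 1)) \<le> 1 / (real K * (p + 1))"
    using assms by (intro divide_right_mono) auto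
  then show ?thesis
    using has_integral_combine[OF _ _ left right] assms(3) by (auto simp: add_divide_distrib)
qed

lemma cell_point_discrepancy_powr_integral:
  fixes x :: "nat \<Rightarrow> real"
  assumes x: "\<And>d. d < K \<Longrightarrow> x d \<in> {real d / real K..<(real d + 1) / real K}"
    and "K > 0" "p > 0"
  shows "\<exists>I \<le> 1 / (p + 1). ((\<lambda>t. \<bar>(\<Sum>d<K. indicator {0..<t} (x d)) - real K * t\<bar> powr p)
           has_integral I) {0..1}"
proof -
  let ?f = "\<lambda>t. \<bar>(\<Sum>d<K. indicator {0..<t} (x d)) - real K * t\<bar> powr p"
  have "\<exists>I \<le> real m / (real K * (p + 1)). (?f has_integral I) {0..real m / real K}" if "m \<le> K" for m
    using that
  proof (induction m)
    case 0
    then show ?case by auto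
  next
    case (Suc m)
    then obtain I where I: "I \<le> real m / (real K * (p + 1))" "(?f has_integral I) {0..real m / real K}"
      by auto
    obtain J where J: "J \<le> 1 / (real K * (p + 1))"
      and "((\<lambda>t. \<bar>indicator {0..<t} (x m) - (real K * t - real m)\<bar> powr p)
           has_integral J) {real m / real K..(real m + 1) / real K}"
      using one_cell_integral[of p K "x m" m] x[of m] assms Suc.prems by auto
    then have "(?f has_integral J) {real m / real K..(real m + 1) / real K}"
    proof (rule_tac has_integral_spike_finite[of "{(real m + 1) / real K}"])
      fix t assume "t \<in> {real m / real K..(real m + 1) / real K} - {(real m + 1) / real K}"
      then have "(\<Sum>d<K. indicator {0..<t} (x d)) = real m + indicator {0..<t} (x m)"
        using Suc.prems x by (intro count_before_cell_point) auto
      then show "?f t = \<bar>indicator {0..<t} (x m) - (real K * t - real m)\<bar> powr p"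
        by (simp add: algebra_simps)
    qed auto
    then have "(?f has_integral (I + J)) {0..(real m + 1) / real K}"
      using I(2) assms(2)
      by (intro has_integral_combine[where c = "real m / real K"]) (simp_all add: divide_right_mono)
    moreover have "I + J \<le> (real m + 1) / (real K * (p + 1))"
      using I(1) J by (simp add: add_divide_distrib)
    ultimately show ?case by (auto simp: add.commute)
  qed
  from this[of K] show ?thesis using assms(2) by simp
qed

section \<open>Discrepancy of a block\<close>

lemma one_per_cell_enumeration:
  assumes bij: "bij_betw (\<lambda>i. nat \<lfloor>real K * q i\<rfloor>) A {..<K}"
    and q: "\<And>i. i \<in> A \<Longrightarrow> 0 \<le> q i"
  shows "\<exists>x :: nat \<Rightarrow> real. (\<forall>c<K. x c \<in> {real c / real K..<(real c + 1) / real K}) \<and>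
    (\<forall>h :: real \<Rightarrow> real. (\<Sum>i\<in>A. h (q i)) = (\<Sum>c<K. h (x c)))"
proof -
  define e where "e = inv_into A (\<lambda>i. nat \<lfloor>real K * q i\<rfloor>)"
  have e: "bij_betw e {..<K} A" unfolding e_def by (rule bij_betw_inv_into[OF bij])
  have "q (e c) \<in> {real c / real K..<(real c + 1) / real K}" if c: "c < K" for c
  proof -
    have eA: "e c \<in> A" using bij_betwE[OF e] c by simp
    have "nat \<lfloor>real K * q (e c)\<rfloor> = c"
      using bij_betw_inv_into_right[OF bij] c unfolding e_def by simp
    moreover have "0 \<le> \<lfloor>real K * q (e c)\<rfloor>" using q[OF eA] by simp
    ultimately have "\<lfloor>real K * q (e c)\<rfloor> = int c" by linarith
    then have "real c \<le> real K * q (e c)" "real K * q (e c) < real c + 1"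
      by (simp_all add: floor_eq_iff)
    then show ?thesis using c by (simp add: field_simps)
  qed
  moreover have "(\<Sum>i\<in>A. h (q i)) = (\<Sum>c<K. h (q (e c)))" for h :: "real \<Rightarrow> real"
    using sum.reindex_bij_betw[OF e, of "\<lambda>i. h (q i)"] by simp
  ultimately show ?thesis by (intro exI[of _ "\<lambda>c. q (e c)"]) blast
qed

lemma guided_block_enumeration:
  assumes "b > 1" "S_box_seq b s" "S_box_guided b s q"
  shows "\<exists>x :: nat \<Rightarrow> real. (\<forall>c<b ^ j. x c \<in> {real c / real (b ^ j)..<(real c + 1) / real (b ^ j)}) \<and>
    (\<forall>h :: real \<Rightarrow> real. (\<Sum>i\<in>aligned_block b j a. h (q i)) = (\<Sum>c<b ^ j. h (x c)))"
  using assms(3) unfolding S_box_guided_def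
  by (intro one_per_cell_enumeration guided_block_one_per_cell[OF assms]) auto

text \<open>The measure is subtracted once for each index, not as a multiple of \<open>card A\<close>. The function is then
  a plain sum over \<open>A\<close> and inherits every decomposition of the index set.\<close>

definition local_discrepancy :: "(nat \<Rightarrow> real) \<Rightarrow> nat set \<Rightarrow> real set \<Rightarrow> real" where
  "local_discrepancy q A B = (\<Sum>i\<in>A. indicator B (q i) - measure lebesgue B)"

lemma measure_lebesgue_between:
  assumes "0 \<le> t" "{0..<t} \<subseteq> B" "B \<subseteq> {0..t}"
  shows "measure lebesgue B = t"
proof -
  have "B = {0..<t} \<or> B = {0..t}"
    using assms by (cases "t \<in> B") (auto simp: less_le)
  then show ?thesis using assms(1) by auto
qed

lemma guided_block_discrepancy_le_1:
  assumes "b > 1" "S_box_seq b s" "S_box_guided b s q"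
    and "0 \<le> t" "t < 1" "{0..<t} \<subseteq> B" "B \<subseteq> {0..t}"
  shows "\<bar>local_discrepancy q (aligned_block b j a) B\<bar> \<le> 1"
proof -
  obtain x where x: "\<And>c. c < b ^ j \<Longrightarrow> x c \<in> {real c / real (b ^ j)..<(real c + 1) / real (b ^ j)}"
    and sums: "\<And>h :: real \<Rightarrow> real. (\<Sum>i\<in>aligned_block b j a. h (q i)) = (\<Sum>c<b ^ j. h (x c))"
    using guided_block_enumeration[OF assms(1-3), of j a] by metis
  have "local_discrepancy q (aligned_block b j a) B = (\<Sum>c<b ^ j. indicator B (x c)) - real (b ^ j) * t"
    using sums[of "\<lambda>y. indicator B y"] measure_lebesgue_between[OF assms(4,6,7)]
    by (simp add: local_discrepancy_def sum_subtractf)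
  then show ?thesis
    using cell_point_discrepancy_le_1[OF x _ assms(4-7)] assms(1) by simp
qed

lemma guided_block_discrepancy_powr_integral:
  assumes "b > 1" "S_box_seq b s" "S_box_guided b s q" and "p > 0"
  shows "\<exists>I \<le> 1 / (p + 1). ((\<lambda>t. \<bar>local_discrepancy q (aligned_block b j a) {0..<t}\<bar> powr p)
           has_integral I) {0..1}"
proof -
  obtain x where x: "\<And>c. c < b ^ j \<Longrightarrow> x c \<in> {real c / real (b ^ j)..<(real c + 1) / real (b ^ j)}"
    and sums: "\<And>h :: real \<Rightarrow> real. (\<Sum>i\<in>aligned_block b j a. h (q i)) = (\<Sum>c<b ^ j. h (x c))"
    using guided_block_enumeration[OF assms(1-3), of j a] by metis
  have eq: "local_discrepancy q (aligned_block b j a) {0..<t}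
      = (\<Sum>c<b ^ j. indicator {0..<t} (x c)) - real (b ^ j) * t" if "t \<in> {0..1}" for t
    using sums[of "\<lambda>y. indicator {0..<t} y"] that
    by (simp add: local_discrepancy_def sum_subtractf)
  obtain I where I: "I \<le> 1 / (p + 1)"
    and int: "((\<lambda>t. \<bar>(\<Sum>c<b ^ j. indicator {0..<t} (x c)) - real (b ^ j) * t\<bar> powr p)
           has_integral I) {0..1}"
    using cell_point_discrepancy_powr_integral[OF x _ assms(4)] assms(1) by auto
  have "((\<lambda>t. \<bar>local_discrepancy q (aligned_block b j a) {0..<t}\<bar> powr p) has_integral I) {0..1}"
    by (rule has_integral_eq[OF _ int]) (simp only: eq)
  with I show ?thesis by blast
qed

section \<open>Cutting an initial segment into blocks\<close>

lemma sum_consecutive_blocks: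
  fixes h :: "nat \<Rightarrow> real"
  assumes "u \<le> v"
  shows "(\<Sum>a\<in>{u..<v}. \<Sum>i\<in>aligned_block b j a. h i) = (\<Sum>i\<in>{u * b ^ j..<v * b ^ j}. h i)"
  using assms
proof (induction v rule: dec_induct)
  case (step v)
  have "(\<Sum>i\<in>{u * b ^ j..<Suc v * b ^ j}. h i)
      = (\<Sum>i\<in>{u * b ^ j..<v * b ^ j}. h i) + (\<Sum>i\<in>{v * b ^ j..<Suc v * b ^ j}. h i)"
    using step.hyps by (subst sum.atLeastLessThan_concat) auto
  then show ?case using step by (simp add: aligned_block_def)
qed simp

text \<open>If the \<open>\<epsilon> j\<close> are the base \<open>b\<close> digits of \<open>D 0\<close>, then \<open>D j\<close> is the integer part of \<open>D 0 / b ^ j\<close>.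
  The truncations \<open>D j * b ^ j\<close> climb from \<open>0\<close> to \<open>D 0\<close> as \<open>j\<close> decreases from \<open>n + 1\<close> to \<open>0\<close>, and
  the step from \<open>j + 1\<close> to \<open>j\<close> consists of \<open>\<epsilon> j\<close> aligned blocks of length \<open>b ^ j\<close>.\<close>

lemma lower_block_decomposition:
  fixes h :: "nat \<Rightarrow> real" and D \<epsilon> :: "nat \<Rightarrow> nat"
  assumes "\<And>j. j \<le> n \<Longrightarrow> D j = b * D (Suc j) + \<epsilon> j" "D (Suc n) = 0"
  shows "(\<Sum>i<D 0. h i)
    = (\<Sum>(j, a)\<in>(SIGMA j:{..n}. {b * D (Suc j)..<D j}). \<Sum>i\<in>aligned_block b j a. h i)"
proof -
  have "(\<Sum>j\<le>m. \<Sum>a\<in>{b * D (Suc j)..<D j}. \<Sum>i\<in>aligned_block b j a. h i)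
      = (\<Sum>i\<in>{D (Suc m) * b ^ Suc m..<D 0}. h i) \<and> D (Suc m) * b ^ Suc m \<le> D 0" if "m \<le> n" for m
    using that
  proof (induction m)
    case 0
    then show ?case
      using sum_consecutive_blocks[of "b * D 1" "D 0" h b 0] assms(1)[of 0] by (simp add: mult.commute)
  next
    case (Suc m)
    have le: "b * D (Suc (Suc m)) \<le> D (Suc m)" using assms(1)[of "Suc m"] Suc.prems by simp
    have start: "D (Suc (Suc m)) * b ^ Suc (Suc m) = b * D (Suc (Suc m)) * b ^ Suc m" by simp
    have below: "b * D (Suc (Suc m)) * b ^ Suc m \<le> D (Suc m) * b ^ Suc m"
      using le by (rule mult_le_mono1)
    have IH: "(\<Sum>j\<le>m. \<Sum>a\<in>{b * D (Suc j)..<D j}. \<Sum>i\<in>aligned_block b j a. h i)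
        = (\<Sum>i\<in>{D (Suc m) * b ^ Suc m..<D 0}. h i)" "D (Suc m) * b ^ Suc m \<le> D 0"
      using Suc by simp_all
    show ?case
      unfolding sum.atMost_Suc start IH(1) sum_consecutive_blocks[OF le]
      using below IH(2) sum.atLeastLessThan_concat[OF below IH(2), of h] by linarith
  qed
  from this[of n] have "(\<Sum>i<D 0. h i)
      = (\<Sum>j\<le>n. \<Sum>a\<in>{b * D (Suc j)..<D j}. \<Sum>i\<in>aligned_block b j a. h i)"
    using assms(2) by (simp add: lessThan_atLeast0)
  also have "\<dots> = (\<Sum>(j, a)\<in>(SIGMA j:{..n}. {b * D (Suc j)..<D j}). \<Sum>i\<in>aligned_block b j a. h i)"
    by (rule sum.Sigma) auto
  finally show ?thesis .
qed

text \<open>The counterpart that approaches \<open>D 0\<close> from above: the numbers \<open>(D j + 1) * b ^ j\<close> climb from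
  \<open>D 0 + 1\<close> to \<open>b ^ (n + 1)\<close>, and each step consists of \<open>b - 1 - \<epsilon> j\<close> aligned blocks. The index
  \<open>D 0\<close> itself is left over.\<close>

lemma upper_block_decomposition:
  fixes h :: "nat \<Rightarrow> real" and D \<epsilon> :: "nat \<Rightarrow> nat"
  assumes "\<And>j. j \<le> n \<Longrightarrow> D j = b * D (Suc j) + \<epsilon> j" "\<And>j. j \<le> n \<Longrightarrow> \<epsilon> j < b" "D (Suc n) = 0"
  shows "(\<Sum>i<b ^ Suc n. h i) = (\<Sum>i<D 0. h i) + h (D 0)
    + (\<Sum>(j, a)\<in>(SIGMA j:{..n}. {D j + 1..<b * (D (Suc j) + 1)}). \<Sum>i\<in>aligned_block b j a. h i)"
proof -
  have telescope: "(\<Sum>j\<le>m. \<Sum>a\<in>{D j + 1..<b * (D (Suc j) + 1)}. \<Sum>i\<in>aligned_block b j a. h i)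
      = (\<Sum>i\<in>{D 0 + 1..<(D (Suc m) + 1) * b ^ Suc m}. h i)
      \<and> D 0 + 1 \<le> (D (Suc m) + 1) * b ^ Suc m" if "m \<le> n" for m
    using that
  proof (induction m)
    case 0
    have le: "D 0 + 1 \<le> b * (D 1 + 1)" using assms(1)[of 0] assms(2)[of 0] by simp
    show ?case
      using sum_consecutive_blocks[OF le, of h b 0] le by (simp add: mult.commute)
  next
    case (Suc m)
    have le: "D (Suc m) + 1 \<le> b * (D (Suc (Suc m)) + 1)"
      using assms(1,2)[of "Suc m"] Suc.prems by simp
    then have above: "(D (Suc m) + 1) * b ^ Suc m \<le> b * (D (Suc (Suc m)) + 1) * b ^ Suc m"
      by (rule mult_le_mono1)
    have stop: "(D (Suc (Suc m)) + 1) * b ^ Suc (Suc m) = b * (D (Suc (Suc m)) + 1) * b ^ Suc m"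
      by (simp only: power_Suc mult_ac)
    have IH: "(\<Sum>j\<le>m. \<Sum>a\<in>{D j + 1..<b * (D (Suc j) + 1)}. \<Sum>i\<in>aligned_block b j a. h i)
        = (\<Sum>i\<in>{D 0 + 1..<(D (Suc m) + 1) * b ^ Suc m}. h i)"
      "D 0 + 1 \<le> (D (Suc m) + 1) * b ^ Suc m"
      using Suc by simp_all
    show ?case
      unfolding sum.atMost_Suc stop IH(1) sum_consecutive_blocks[OF le]
      using above IH(2) sum.atLeastLessThan_concat[OF IH(2) above, of h] by linarith
  qed
  from telescope[of n] have
    "(\<Sum>(j, a)\<in>(SIGMA j:{..n}. {D j + 1..<b * (D (Suc j) + 1)}). \<Sum>i\<in>aligned_block b j a. h i)
      = (\<Sum>i\<in>{D 0 + 1..<b ^ Suc n}. h i)"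
    using assms(3) by (subst sum.Sigma[symmetric]) simp_all
  moreover have "D 0 + 1 \<le> b ^ Suc n" using telescope[of n] assms(3) by simp
  then have "(\<Sum>i<D 0 + 1. h i) + (\<Sum>i\<in>{D 0 + 1..<b ^ Suc n}. h i) = (\<Sum>i<b ^ Suc n. h i)"
    using sum.atLeastLessThan_concat[of 0 "D 0 + 1" "b ^ Suc n" h] by (simp add: lessThan_atLeast0)
  ultimately show ?thesis by simp
qed

text \<open>Quantifying over all summands \<open>h\<close> says that the indicator function of \<open>[0, N)\<close> is the combination,
  with signs \<open>\<sigma>\<close>, of the indicator functions of the blocks listed in \<open>L\<close> as pairs of level and
  position.\<close>

definition signed_block_decomposition ::
    "nat \<Rightarrow> nat \<Rightarrow> (nat \<times> nat) set \<Rightarrow> (nat \<times> nat \<Rightarrow> real) \<Rightarrow> bool" where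
  "signed_block_decomposition b N L \<sigma> \<longleftrightarrow> finite L \<and> (\<forall>l\<in>L. \<bar>\<sigma> l\<bar> = 1) \<and>
     (\<forall>h :: nat \<Rightarrow> real. (\<Sum>i<N. h i) = (\<Sum>l\<in>L. \<sigma> l * (\<Sum>i\<in>aligned_block b (fst l) (snd l). h i)))"

text \<open>The two counts are the two entries of the minimum in the theorem. The first uses the blocks of
  \<open>[0, N)\<close> itself. The second takes the whole of \<open>[0, b ^ (n + 1))\<close>, one block, and removes the
  blocks of its complement: one for the single index \<open>N\<close>, and \<open>b - 1 - \<epsilon> j\<close> at each level \<open>j\<close>.\<close>

lemma decomposition_by_digit_sum:
  fixes \<epsilon> :: "nat \<Rightarrow> nat"
  assumes "N = (\<Sum>j=0..n. \<epsilon> j * b ^ j)"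
  shows "\<exists>L \<sigma>. signed_block_decomposition b N L \<sigma> \<and> real (card L) = (\<Sum>j=0..n. real (\<epsilon> j))"
    and "b > 1 \<Longrightarrow> \<forall>j\<le>n. \<epsilon> j < b \<Longrightarrow> \<exists>L \<sigma>. signed_block_decomposition b N L \<sigma> \<and>
      real (card L) = real b * (real n + 1) - real n + 1 - (\<Sum>j=0..n. real (\<epsilon> j))"
proof -
  define D where "D j = (\<Sum>i\<in>{j..n}. \<epsilon> i * b ^ (i - j))" for j
  have D0: "D 0 = N" and Dn: "D (Suc n) = 0" using assms by (simp_all add: D_def)
  have Drec: "D j = b * D (Suc j) + \<epsilon> j" if "j \<le> n" for j
  proof -
    have "D j = \<epsilon> j + (\<Sum>i\<in>{Suc j..n}. \<epsilon> i * b ^ (i - j))"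
      using that by (simp add: D_def sum.atLeast_Suc_atMost)
    also have "(\<Sum>i\<in>{Suc j..n}. \<epsilon> i * b ^ (i - j)) = b * D (Suc j)"
      unfolding D_def sum_distrib_left
    proof (rule sum.cong[OF refl])
      fix i assume "i \<in> {Suc j..n}"
      then have "Suc j \<le> i" by simp
      then have "i - j = Suc (i - Suc j)" by arith
      then show "\<epsilon> i * b ^ (i - j) = b * (\<epsilon> i * b ^ (i - Suc j))" by simp
    qed
    finally show ?thesis by simp
  qed
  define L where "L = (SIGMA j:{..n}. {b * D (Suc j)..<D j})"
  have "card L = (\<Sum>j\<le>n. \<epsilon> j)" unfolding L_def using Drec by simp
  moreover have "signed_block_decomposition b N L (\<lambda>_. 1)"
    unfolding signed_block_decomposition_def D0[symmetric]
    using lower_block_decomposition[OF Drec Dn] by (auto simp: L_def case_prod_unfold)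
  ultimately show "\<exists>L \<sigma>. signed_block_decomposition b N L \<sigma> \<and> real (card L) = (\<Sum>j=0..n. real (\<epsilon> j))"
    by (auto simp: atMost_atLeast0)
  assume b: "b > 1" and "\<forall>j\<le>n. \<epsilon> j < b"
  then have digit: "\<epsilon> j < b" if "j \<le> n" for j using that by simp
  define U where "U = (SIGMA j:{..n}. {D j + 1..<b * (D (Suc j) + 1)})"
  \<comment> \<open>The blocks \<open>(Suc n, 0)\<close> and \<open>(0, N)\<close> are \<open>[0, b ^ (n + 1))\<close> and \<open>{N}\<close>.\<close>
  define L' where "L' = insert (Suc n, 0) (insert (0, N) U)"
  define \<sigma> :: "nat \<times> nat \<Rightarrow> real" where "\<sigma> l = (if fst l = Suc n then 1 else - 1)" for l
  have fin: "finite U" by (auto simp: U_def)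
  have new: "(0, N) \<notin> U" "(Suc n, 0) \<notin> insert (0, N) U" by (auto simp: U_def D0)
  have "real (card U) = (\<Sum>j\<le>n. real (b * (D (Suc j) + 1) - (D j + 1)))" by (simp add: U_def)
  also have "\<dots> = (\<Sum>j\<le>n. (real b - 1) - real (\<epsilon> j))"
  proof (rule sum.cong[OF refl])
    fix j assume "j \<in> {..n}"
    then have "b * (D (Suc j) + 1) - (D j + 1) = b - 1 - \<epsilon> j" "\<epsilon> j \<le> b - 1"
      using Drec[of j] digit[of j] by auto
    then show "real (b * (D (Suc j) + 1) - (D j + 1)) = (real b - 1) - real (\<epsilon> j)"
      using b by (simp add: of_nat_diff)
  qed
  also have "\<dots> = (real n + 1) * (real b - 1) - (\<Sum>j=0..n. real (\<epsilon> j))"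
    by (simp add: sum_subtractf atMost_atLeast0)
  finally have "real (card L') = real b * (real n + 1) - real n + 1 - (\<Sum>j=0..n. real (\<epsilon> j))"
    using new fin by (simp add: L'_def algebra_simps)
  moreover have "signed_block_decomposition b N L' \<sigma>"
    unfolding signed_block_decomposition_def
  proof (intro conjI allI)
    fix h :: "nat \<Rightarrow> real"
    have "(\<Sum>l\<in>U. \<sigma> l * (\<Sum>i\<in>aligned_block b (fst l) (snd l). h i))
        = - (\<Sum>(j, a)\<in>U. \<Sum>i\<in>aligned_block b j a. h i)"
      unfolding sum_negf[symmetric] by (intro sum.cong) (auto simp: U_def \<sigma>_def)
    moreover have "(\<Sum>i<b ^ Suc n. h i) = (\<Sum>i<N. h i) + h N + (\<Sum>(j, a)\<in>U. \<Sum>i\<in>aligned_block b j a. h i)"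
      using upper_block_decomposition[OF Drec digit Dn, of h] unfolding D0 U_def .
    ultimately show "(\<Sum>i<N. h i) = (\<Sum>l\<in>L'. \<sigma> l * (\<Sum>i\<in>aligned_block b (fst l) (snd l). h i))"
      using new fin
      by (simp add: L'_def \<sigma>_def aligned_block_def lessThan_atLeast0[symmetric])
  qed (use fin in \<open>auto simp: L'_def \<sigma>_def\<close>)
  ultimately show "\<exists>L \<sigma>. signed_block_decomposition b N L \<sigma> \<and>
      real (card L) = real b * (real n + 1) - real n + 1 - (\<Sum>j=0..n. real (\<epsilon> j))"
    by blast
qed

section \<open>Discrepancy of an initial segment\<close>

lemma local_discrepancy_decomposition:
  assumes "signed_block_decomposition b N L \<sigma>"
  shows "local_discrepancy q {..<N} B
    = (\<Sum>l\<in>L. \<sigma> l * local_discrepancy q (aligned_block b (fst l) (snd l)) B)"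
  using assms unfolding signed_block_decomposition_def local_discrepancy_def by blast

lemma size_initial_segment [simp]: "size (initial_segment q N) = N"
  by (simp add: initial_segment_def)

lemma local_discrepancy_initial_segment:
  "(\<Sum>x\<in>#initial_segment q N. indicator B x) - real N * measure lebesgue B = local_discrepancy q {..<N} B"
  by (simp add: initial_segment_def local_discrepancy_def sum_subtractf sum_unfold_sum_mset[symmetric]
      image_mset.compositionality comp_def lessThan_atLeast0)

lemma guided_discr_sup_le:
  assumes "b > 1" "S_box_seq b s" "S_box_guided b s q" "N \<ge> 1"
    and "signed_block_decomposition b N L \<sigma>"
  shows "real N * discr_sup (initial_segment q N) {{0..t} | t. 0 < t \<and> t < 1} \<le> real (card L)"
proof -
  have "\<bar>local_discrepancy q {..<N} B\<bar> \<le> real (card L)" if B: "B \<in> {{0..t} | t. 0 < t \<and> t < 1}" for B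
  proof -
    obtain t where t: "B = {0..t}" "0 < t" "t < 1" using B by blast
    have "\<bar>local_discrepancy q {..<N} B\<bar>
        \<le> (\<Sum>l\<in>L. \<bar>\<sigma> l * local_discrepancy q (aligned_block b (fst l) (snd l)) B\<bar>)"
      unfolding local_discrepancy_decomposition[OF assms(5)] by (rule sum_abs)
    also have "\<dots> \<le> (\<Sum>l\<in>L. 1)"
    proof (rule sum_mono)
      fix l assume "l \<in> L"
      then have "\<bar>\<sigma> l\<bar> = 1" using assms(5) by (auto simp: signed_block_decomposition_def)
      then show "\<bar>\<sigma> l * local_discrepancy q (aligned_block b (fst l) (snd l)) B\<bar> \<le> 1"
        using guided_block_discrepancy_le_1[OF assms(1-3), of t B "fst l" "snd l"] t
        by (simp add: abs_mult atLeastLessThan_subseteq_atLeastAtMost_iff)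
    qed
    finally show ?thesis by simp
  qed
  moreover have "{0..1/2} \<in> {{0..t} | t. 0 < t \<and> t < (1::real)}"
    by (intro CollectI exI[of _ "1/2"]) auto
  ultimately have "(SUP B\<in>{{0..t} | t. 0 < t \<and> t < 1}. \<bar>local_discrepancy q {..<N} B\<bar>) \<le> real (card L)"
    by (intro cSUP_least) auto
  then show ?thesis
    using assms(4) unfolding discr_sup_def size_initial_segment local_discrepancy_initial_segment by simp
qed

text \<open>Integrating the pointwise power inequality termwise and bounding each block by \<open>1 / (p + 1)\<close> leaves
  the number of blocks times the constant of that inequality. The integrals of the blocks come as
  gauge integrals and the discrepancy is a Lebesgue integral; they meet because the total is bounded
  and Borel measurable.\<close>

lemma guided_discr_le:
  assumes "b > 1" "S_box_seq b s" "S_box_guided b s q" "N \<ge> 1" "p > 0"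
    and dec: "signed_block_decomposition b N L \<sigma>"
  shows "real N * discr p (initial_segment q N) powr (1 / p)
    \<le> ((if p < 1 then 1 else real (card L) powr (p - 1)) * real (card L) / (p + 1)) powr (1 / p)"
proof -
  define F where "F t = \<bar>local_discrepancy q {..<N} {0..<t}\<bar> powr p" for t
  define C where "C = (if p < 1 then 1 else real (card L) powr (p - 1))"
  have C: "C \<ge> 0" by (simp add: C_def)
  have L: "finite L" "\<And>l. l \<in> L \<Longrightarrow> \<bar>\<sigma> l\<bar> = 1"
    using dec by (auto simp: signed_block_decomposition_def)
  let ?g = "\<lambda>l t. \<bar>local_discrepancy q (aligned_block b (fst l) (snd l)) {0..<t}\<bar> powr p"
  have "\<exists>I. \<forall>l. I l \<le> 1 / (p + 1) \<and> (?g l has_integral I l) {0..1}"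
    using guided_block_discrepancy_powr_integral[OF assms(1-3,5)] by (intro choice) blast
  then obtain I where I: "\<And>l. I l \<le> 1 / (p + 1)" "\<And>l. (?g l has_integral I l) {0..1}" by blast
  have q: "0 \<le> q i" for i using assms(3) unfolding S_box_guided_def by auto
  \<comment> \<open>As a function of \<open>t\<close>, the indicator of \<open>{0..<t}\<close> at \<open>q i\<close> is a step function, visibly measurable.\<close>
  have F_eq: "F t = \<bar>(\<Sum>i<N. (if q i < t then 1 else 0) - t)\<bar> powr p" if "t \<in> {0..1}" for t
    using that q by (simp add: F_def local_discrepancy_def indicator_def of_bool_def)
  have "set_integrable lborel {0..1} (\<lambda>t. \<bar>(\<Sum>i<N. (if q i < t then 1 else 0) - t)\<bar> powr p)"
    unfolding set_integrable_def
  proof (rule integrableI_bounded_set_indicator[where B = "real N powr p"])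
    show "(\<lambda>t. \<bar>(\<Sum>i<N. (if q i < t then 1 else 0) - t)\<bar> powr p) \<in> borel_measurable lborel"
      by measurable
    show "AE t in lborel. t \<in> {0..1} \<longrightarrow>
        norm (\<bar>(\<Sum>i<N. (if q i < t then 1 else 0) - t)\<bar> powr p) \<le> real N powr p"
    proof (intro AE_I2 impI)
      fix t :: real assume t: "t \<in> {0..1}"
      have "\<bar>(\<Sum>i<N. (if q i < t then 1 else 0) - t)\<bar> \<le> (\<Sum>i<N. \<bar>(if q i < t then 1 else 0) - t\<bar>)"
        by (rule sum_abs)
      also have "\<dots> \<le> (\<Sum>i<N. 1)" using t by (intro sum_mono) auto
      finally show "norm (\<bar>(\<Sum>i<N. (if q i < t then 1 else 0) - t)\<bar> powr p) \<le> real N powr p"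
        using assms(5) by (auto intro: powr_mono2)
    qed
  qed auto
  then have int: "set_integrable lborel {0..1} F"
    by (subst set_integrable_cong[OF refl refl F_eq]) auto
  have "(LBINT t:{0..1}. F t) = integral {0..1} F"
    by (rule set_borel_integral_eq_integral(2)[OF int])
  also have "\<dots> \<le> C * (\<Sum>l\<in>L. I l)"
  proof (rule has_integral_le)
    show "(F has_integral integral {0..1} F) {0..1}"
      using set_borel_integral_eq_integral(1)[OF int] by (rule integrable_integral)
    show "((\<lambda>t. C * (\<Sum>l\<in>L. ?g l t)) has_integral C * (\<Sum>l\<in>L. I l)) {0..1}"
      using I(2) L(1) by (intro has_integral_mult_right has_integral_sum)
    fix t :: real
    have "F t \<le> C * (\<Sum>l\<in>L. \<bar>\<sigma> l * local_discrepancy q (aligned_block b (fst l) (snd l)) {0..<t}\<bar> powr p)"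
      unfolding F_def C_def local_discrepancy_decomposition[OF dec]
      by (rule abs_sum_powr_le[OF L(1) assms(5)])
    also have "\<dots> = C * (\<Sum>l\<in>L. ?g l t)" using L(2) by (simp add: abs_mult)
    finally show "F t \<le> C * (\<Sum>l\<in>L. ?g l t)" .
  qed
  also have "\<dots> \<le> C * (\<Sum>l\<in>L. 1 / (p + 1))"
    using C I(1) by (intro mult_left_mono sum_mono)
  also have "\<dots> = C * real (card L) / (p + 1)" by simp
  finally have le: "(LBINT t:{0..1}. F t) \<le> C * real (card L) / (p + 1)" .
  have nonneg: "0 \<le> (LBINT t:{0..1}. F t)"
    unfolding set_lebesgue_integral_def by (intro integral_nonneg_AE) (auto simp: F_def)
  have "discr p (initial_segment q N) = (LBINT t:{0..1}. F t) / real N powr p"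
  proof -
    have "(LBINT t:{0..1}. \<bar>(\<Sum>x\<in>#initial_segment q N. indicator {0..<t} x) - real N * t\<bar> powr p)
        = (LBINT t:{0..1}. F t)"
    proof (intro set_lebesgue_integral_cong allI impI)
      fix t :: real assume "t \<in> {0..1}"
      then have "(\<Sum>x\<in>#initial_segment q N. indicator {0..<t} x) - real N * t
          = local_discrepancy q {..<N} {0..<t}"
        using local_discrepancy_initial_segment[where B = "{0..<t}" and q = q and N = N] by simp
      then show "\<bar>(\<Sum>x\<in>#initial_segment q N. indicator {0..<t} x) - real N * t\<bar> powr p = F t"
        by (simp add: F_def)
    qed simp
    then show ?thesis by (simp add: discr_def)
  qed
  then have "real N * discr p (initial_segment q N) powr (1 / p) = (LBINT t:{0..1}. F t) powr (1 / p)"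
    using assms(4,5) nonneg by (simp add: powr_divide powr_powr)
  also have "\<dots> \<le> (C * real (card L) / (p + 1)) powr (1 / p)"
    using le nonneg assms(5) by (intro powr_mono2) auto
  finally show ?thesis by (simp add: C_def)
qed

theorem theorem5:
  fixes b N n :: nat and s q :: "nat \<Rightarrow> real" and \<epsilon> :: "nat \<Rightarrow> nat" and M :: real
  assumes "b > 1"
    and "S_box_seq b s"
    and "S_box_guided b s q"
    and "N \<ge> 1"
    and "n = nat \<lfloor>ln (real N) / ln (real b)\<rfloor>"
    and "\<forall>j\<le>n. \<epsilon> j \<in> {0..b - 1}"
    and "N = (\<Sum>j=0..n. \<epsilon> j * b ^ j)"
    and "M = min (\<Sum>j=0..n. real (\<epsilon> j))
                 (real b * (real n + 1) - real n + 1 - (\<Sum>j=0..n. real (\<epsilon> j)))"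
  shows "(\<forall>p. 0 < p \<and> p < 1 \<longrightarrow>
            real N * discr p (initial_segment q N) powr (1 / p)
              \<le> 2 * (M / (p + 1)) powr (1 / p))
       \<and> (\<forall>p\<ge>1.
            real N * discr p (initial_segment q N) powr (1 / p)
              \<le> 2 * (M / (p + 1) powr (1 / p)))
       \<and> real N * discr_sup (initial_segment q N) {{0..t} | t. 0 < t \<and> t < 1} \<le> 2 * M"
proof -
  have digit: "\<forall>j\<le>n. \<epsilon> j < b" using assms(1,6) by fastforce
  obtain L \<sigma> where dec: "signed_block_decomposition b N L \<sigma>" and M: "M = real (card L)"
    using decomposition_by_digit_sum(1)[OF assms(7)]
      decomposition_by_digit_sum(2)[OF assms(7,1) digit] assms(8)
    unfolding min_def by metis
  have double: "x \<le> 2 * y" if "x \<le> y" "0 \<le> y" for x y :: real using that by simp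
  show ?thesis
  proof (intro conjI allI impI)
    fix p :: real assume "0 < p \<and> p < 1"
    then show "real N * discr p (initial_segment q N) powr (1 / p) \<le> 2 * (M / (p + 1)) powr (1 / p)"
      using guided_discr_le[OF assms(1-4) _ dec, of p] by (intro double) (auto simp: M)
  next
    fix p :: real assume p: "1 \<le> p"
    \<comment> \<open>With \<open>K\<close> blocks the bound is \<open>K powr (p - 1) * K = K powr p\<close>, and the root returns \<open>K\<close>.\<close>
    have "(real (card L) powr (p - 1) * real (card L) / (p + 1)) powr (1 / p) = M / (p + 1) powr (1 / p)"
    proof (cases "card L = 0")
      case False
      then have "real (card L) powr (p - 1) * real (card L) = real (card L) powr p"
        by (simp add: powr_diff)
      then show ?thesis using p by (simp add: M powr_divide powr_powr)
    qed (simp add: M)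
    then show "real N * discr p (initial_segment q N) powr (1 / p) \<le> 2 * (M / (p + 1) powr (1 / p))"
      using guided_discr_le[OF assms(1-4) _ dec, of p] p by (intro double) (auto simp: M)
  next
    show "real N * discr_sup (initial_segment q N) {{0..t} | t. 0 < t \<and> t < 1} \<le> 2 * M"
      using guided_discr_sup_le[OF assms(1-4) dec] by (intro double) (auto simp: M)
  qed
qed

end
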